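(* For every $\epsilon>0$ there is a deterministic online algorithm for the heterogeneous data-center right-sizing problem with (possibly) time-dependent operating cost functions $f_{t,j}$ that is $(2d+1+\epsilon)$-competitive, i.e. on every instance its schedule has cost at most $(2d+1+\epsilon)$ times the cost of an optimal schedule.
   Context: Notation: $[k]=\{1,\dots,k\}$, $[k]_0=\{0,\dots,k\}$, $(x)^+=\max(x,0)$. Problem: An instance consists of $T\in\mathbb N$ time slots, $d\in\mathbb N$ server types, numbers $m_1,\dots,m_d\in\mathbb N$ of servers of each type, switching costs $\beta_j>0$, capacities $z^{\max}_j>0$, job volumes $\lambda_t\ge 0$ ($t\in[T]$), and operating cost functions $f_{t,j}$ ($t\in[T]$, $j\in[d]$) that are convex, increasing and non-negative on $[0,z^{\max}_j]$ (taking the value $+\infty$ for loads above $z^{\max}_j$). For $x\in\mathbb N_0$, $z\in[0,1]$ put $g_{t,j}(x,z)=x f_{t,j}(\lambda_t z/x)$ if $x>0$, $g_{t,j}(0,z)=\infty$ if $\lambda_t z>0$, $g_{t,j}(0,z)=0$ if $\lambda_t z=0$. Let $\mathcal Z=\{(z_1,\dots,z_d)\in[0,1]^d:\sum_j z_j=1\}$ and $g_t(x_1,\dots,x_d)=\min_{z\in\mathcal Z}\sum_{j}g_{t,j}(x_j,z_j)$. A schedule is $X=(\vec x_1,\dots,\vec x_T)$, $\vec x_t=(x_{t,1},\dots,x_{t,d})$, $x_{t,j}\in[m_j]_0$, with $\vec x_0=\vec x_{T+1}=\vec 0$; it is feasible if also $\sum_j x_{t,j}z^{\max}_j\ge\lambda_t$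 for all $t$. Its cost is $C(X)=\sum_{t=1}^T\big(g_t(\vec x_t)+\sum_j\beta_j(x_{t,j}-x_{t-1,j})^+\big)$. An optimal schedule is a feasible schedule of minimum cost. Online setting: $T,d,\vec m,\vec\beta$ are known; at slot $t$ the algorithm learns $\lambda_t$ and $f_{t,1},\dots,f_{t,d}$ and must fix $\vec x_t$ without knowledge of later slots. A deterministic online algorithm is $c$-competitive if on every instance its cost is at most $c$ times the optimal cost. *)

theory Defs
  imports "HOL-Analysis.Analysis"
begin

text \<open>Time slots are \<open>{1..T}\<close> and server types are \<open>{1..d}\<close>; values of the fields below at
  other indices are irrelevant. Operating costs are extended-real valued, so a cost function
  determines its capacity as the last load of finite cost.\<close>

record dc_problem =
  horizon  :: nat                                    (* T *)
  ntypes   :: nat                                    (* d *)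
  servers  :: "nat \<Rightarrow> nat"                           (* m_j *)
  swcost   :: "nat \<Rightarrow> real"                          (* beta_j *)
  capacity :: "nat \<Rightarrow> real"                          (* z^max_j *)
  volume   :: "nat \<Rightarrow> real"                          (* lambda_t *)
  opcost   :: "nat \<Rightarrow> nat \<Rightarrow> real \<Rightarrow> ereal"           (* f_{t,j} *)

definition operating_cost_fun :: "real \<Rightarrow> (real \<Rightarrow> ereal) \<Rightarrow> bool" where
  "operating_cost_fun zmax f \<longleftrightarrow>
     (\<forall>z\<in>{0..zmax}. 0 \<le> f z \<and> f z < \<infinity>) \<and>
     mono_on {0..zmax} f \<and>
     convex_on {0..zmax} (\<lambda>z. real_of_ereal (f z)) \<and>
     (\<forall>z>zmax. f z = \<infinity>)"

definition dc_instance :: "dc_problem \<Rightarrow> bool" where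
  "dc_instance I \<longleftrightarrow>
     1 \<le> horizon I \<and> 1 \<le> ntypes I \<and>
     (\<forall>j\<in>{1..ntypes I}. 1 \<le> servers I j \<and> 0 < swcost I j \<and> 0 < capacity I j) \<and>
     (\<forall>t\<in>{1..horizon I}. 0 \<le> volume I t) \<and>
     (\<forall>t\<in>{1..horizon I}. \<forall>j\<in>{1..ntypes I}. operating_cost_fun (capacity I j) (opcost I t j))"

definition type_cost :: "dc_problem \<Rightarrow> nat \<Rightarrow> nat \<Rightarrow> nat \<Rightarrow> real \<Rightarrow> ereal" where
  "type_cost I t j x z =
     (if 0 < x then ereal (real x) * opcost I t j (volume I t * z / real x)
      else if 0 < volume I t * z then \<infinity> else 0)"

definition load_splits :: "nat \<Rightarrow> (nat \<Rightarrow> real) set" where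
  "load_splits d = {z. (\<forall>j\<in>{1..d}. 0 \<le> z j \<and> z j \<le> 1) \<and> (\<Sum>j=1..d. z j) = 1}"

text \<open>The minimum is rendered as an infimum: a convex function may jump upwards at the right
  end of \<open>[0, z\<^sup>m\<^sup>a\<^sup>x]\<close>, and then the minimum need not be attained.\<close>

definition slot_cost :: "dc_problem \<Rightarrow> nat \<Rightarrow> (nat \<Rightarrow> nat) \<Rightarrow> ereal" where
  "slot_cost I t x = (INF z\<in>load_splits (ntypes I). \<Sum>j=1..ntypes I. type_cost I t j (x j) (z j))"

type_synonym schedule = "nat \<Rightarrow> nat \<Rightarrow> nat"

definition is_schedule :: "dc_problem \<Rightarrow> schedule \<Rightarrow> bool" where
  "is_schedule I X \<longleftrightarrow>
     (\<forall>t\<in>{1..horizon I}. \<forall>j\<in>{1..ntypes I}. X t j \<le> servers I j) \<and>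
     (\<forall>j\<in>{1..ntypes I}. X 0 j = 0 \<and> X (horizon I + 1) j = 0)"

definition feasible :: "dc_problem \<Rightarrow> schedule \<Rightarrow> bool" where
  "feasible I X \<longleftrightarrow> is_schedule I X \<and>
     (\<forall>t\<in>{1..horizon I}. volume I t \<le> (\<Sum>j=1..ntypes I. real (X t j) * capacity I j))"

definition schedule_cost :: "dc_problem \<Rightarrow> schedule \<Rightarrow> ereal" where
  "schedule_cost I X =
     (\<Sum>t=1..horizon I. slot_cost I t (X t) +
        ereal (\<Sum>j=1..ntypes I. swcost I j * max (real (X t j) - real (X (t - 1) j)) 0))"

definition optimal :: "dc_problem \<Rightarrow> schedule \<Rightarrow> bool" where
  "optimal I X \<longleftrightarrow> feasible I X \<and> (\<forall>Y. feasible I Y \<longrightarrow> schedule_cost I X \<le> schedule_cost I Y)"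

definition same_information :: "nat \<Rightarrow> dc_problem \<Rightarrow> dc_problem \<Rightarrow> bool" where
  "same_information t I I' \<longleftrightarrow>
     horizon I = horizon I' \<and> ntypes I = ntypes I' \<and>
     (\<forall>j\<in>{1..ntypes I}. servers I j = servers I' j \<and> swcost I j = swcost I' j) \<and>
     (\<forall>s\<in>{1..t}. volume I s = volume I' s \<and>
        (\<forall>j\<in>{1..ntypes I}. \<forall>z\<ge>0. opcost I s j z = opcost I' s j z))"

text \<open>A deterministic online algorithm maps instances to schedules such that the decision for
  slot \<open>t\<close> is a function of the information revealed up to and including slot \<open>t\<close>.\<close>

definition online_algorithm :: "(dc_problem \<Rightarrow> schedule) \<Rightarrow> bool" where
  "online_algorithm A \<longleftrightarrow>
     (\<forall>I. dc_instance I \<longrightarrow> is_schedule I (A I)) \<and>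
     (\<forall>I I'. dc_instance I \<longrightarrow> dc_instance I' \<longrightarrow>
        (\<forall>t\<in>{1..horizon I}. same_information t I I' \<longrightarrow>
           (\<forall>j\<in>{1..ntypes I}. A I t j = A I' t j)))"

text \<open>Competitiveness on the instances with \<open>d\<close> server types. An instance whose job volumes
  exceed the total capacity has no feasible, hence no optimal, schedule.\<close>

definition competitive :: "(dc_problem \<Rightarrow> schedule) \<Rightarrow> nat \<Rightarrow> real \<Rightarrow> bool" where
  "competitive A d c \<longleftrightarrow>
     (\<forall>I. dc_instance I \<longrightarrow> ntypes I = d \<longrightarrow> (\<exists>X. feasible I X) \<longrightarrow>
        feasible I (A I) \<and>
        (\<forall>X. optimal I X \<longrightarrow> schedule_cost I (A I) \<le> ereal c * schedule_cost I X))"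

end

theory Submission
  imports Defs
begin

text \<open>In slot \<open>t\<close> the algorithm computes an optimal schedule for the first \<open>t\<close> slots and makes
  sure that at least the servers used by its last state, the demand, are running. The operating
  costs of the demands sum up to at most OPT, since truncating an optimal prefix schedule gives a
  competitor on the shorter prefix.

  Servers beyond the demand are handled as in ski rental: a server is shut down as soon as its
  idle cost since it was last demanded would exceed \<open>\<beta>\<^sub>j\<close>. Keeping it costs at most its idle
  cost by convexity. Call the debt of a server its idle cost since the last demand, capped at
  \<open>\<beta>\<^sub>j\<close>, and \<open>\<beta>\<^sub>j\<close> before the first demand. Debts collected when servers are demanded are a
  lower bound on OPT for each type \<open>j\<close> separately, by an invariant on the work function, and
  switching plus idle costs are at most twice the collected debts. This gives the factor
  \<open>2 d + 1\<close>; because \<open>f\<^sub>t\<^sub>,\<^sub>j\<close> is known before the decision for slot \<open>t\<close>, the idle cost never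
  overshoots \<open>\<beta>\<^sub>j\<close> and no additive loss occurs.\<close>

section \<open>Ski rental\<close>

context
  fixes b :: real and l :: "nat \<Rightarrow> real" and r :: "nat \<Rightarrow> bool"
begin

text \<open>A server is requested in the slots \<open>t\<close> with \<open>r t\<close>; starting it costs \<open>b\<close>, keeping it on without
  a request costs \<open>l t\<close>.\<close>

primrec idle_debt :: "nat \<Rightarrow> real" where
  "idle_debt 0 = b"
| "idle_debt (Suc t) = (if r (Suc t) then 0 else min b (idle_debt t + l (Suc t)))"

primrec kept_on :: "nat \<Rightarrow> bool" where
  "kept_on 0 = False"
| "kept_on (Suc t) \<longleftrightarrow> r (Suc t) \<or> kept_on t \<and> idle_debt t + l (Suc t) \<le> b"

primrec collected_debt :: "nat \<Rightarrow> real" where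
  "collected_debt 0 = 0"
| "collected_debt (Suc t) =
     collected_debt t + (if r (Suc t) then min b (idle_debt t + l (Suc t)) else 0)"

definition rental_cost :: "nat \<Rightarrow> real" where
  "rental_cost t = (\<Sum>s=1..t.
     (if kept_on s \<and> \<not> r s then l s else 0) + (if kept_on s \<and> \<not> kept_on (s - 1) then b else 0))"

lemma idle_debt_bounds:
  assumes "0 \<le> b" "\<And>s. s \<in> {1..t} \<Longrightarrow> 0 \<le> l s"
  shows "0 \<le> idle_debt t" "idle_debt t \<le> b"
  using assms by (induction t) auto

lemma idle_debt_eq_if_off:
  assumes "0 \<le> b" "\<And>s. s \<in> {1..t} \<Longrightarrow> 0 \<le> l s" "\<not> kept_on t"
  shows "idle_debt t = b"
  using assms
proof (induction t)
  case (Suc t)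
  have "0 \<le> l (Suc t)" using Suc.prems by simp
  then show ?case using Suc by (cases "kept_on t") auto
qed simp

lemma rental_cost_le_potential:
  assumes "0 \<le> b" "\<And>s. s \<in> {1..t} \<Longrightarrow> 0 \<le> l s"
  shows "rental_cost t \<le> 2 * collected_debt t + idle_debt t - b"
  using assms
proof (induction t)
  case 0
  then show ?case by (simp add: rental_cost_def)
next
  case (Suc t)
  have idle_nonneg: "0 \<le> l (Suc t)" "\<And>s. s \<in> {1..t} \<Longrightarrow> 0 \<le> l s"
    using Suc.prems by auto
  have "rental_cost t \<le> 2 * collected_debt t + idle_debt t - b"
    using Suc.IH \<open>0 \<le> b\<close> idle_nonneg(2) by simp
  then show ?case
    using idle_debt_eq_if_off[of t] idle_debt_bounds[of t] \<open>0 \<le> b\<close> idle_nonneg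
    by (cases "kept_on t") (auto simp: rental_cost_def min_def)
qed

lemma rental_cost_le_collected_debt:
  assumes "0 \<le> b" "\<And>s. s \<in> {1..t} \<Longrightarrow> 0 \<le> l s"
  shows "rental_cost t \<le> 2 * collected_debt t"
  using rental_cost_le_potential[of t] idle_debt_bounds(2)[of t] assms by simp

end

lemma idle_debt_cong:
  assumes "\<And>s. s \<in> {1..t} \<Longrightarrow> l s = l' s" "\<And>s. s \<in> {1..t} \<Longrightarrow> r s = r' s"
  shows "idle_debt b l r t = idle_debt b l' r' t"
  using assms by (induction t) auto

lemma kept_on_cong:
  assumes "\<And>s. s \<in> {1..t} \<Longrightarrow> l s = l' s" "\<And>s. s \<in> {1..t} \<Longrightarrow> r s = r' s"
  shows "kept_on b l r t = kept_on b l' r' t"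
  using assms
proof (induction t)
  case (Suc t)
  then show ?case using idle_debt_cong[of t l l' r r' b] by simp
qed simp

section \<open>Lanes\<close>

lemma sum_min_le:
  fixes a :: "nat \<Rightarrow> real"
  assumes "k \<le> n"
  shows "(\<Sum>i=1..n. min b (a i + c)) \<le> (\<Sum>i=1..k. a i) + (c * real k + b * (real n - real k))"
proof -
  have "(\<Sum>i=1..n. min b (a i + c)) = (\<Sum>i=1..k. min b (a i + c)) + (\<Sum>i=k+1..n. min b (a i + c))"
    using sum.ub_add_nat[of 1 k "\<lambda>i. min b (a i + c)" "n - k"] assms by simp
  also have "\<dots> \<le> (\<Sum>i=1..k. a i + c) + (\<Sum>i=k+1..n. b)"
    by (intro add_mono sum_mono) auto
  also have "\<dots> = (\<Sum>i=1..k. a i) + (c * real k + b * (real n - real k))"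
    using assms by (simp add: sum.distrib of_nat_diff mult.commute)
  finally show ?thesis .
qed

context
  fixes b :: real and l :: "nat \<Rightarrow> real" and h :: "nat \<Rightarrow> nat"
begin

text \<open>The \<open>m\<close> servers of one type are numbered; of these lanes, the first \<open>h t\<close> are requested in
  slot \<open>t\<close>.\<close>

abbreviation (input) lane_on :: "nat \<Rightarrow> nat \<Rightarrow> bool" where
  "lane_on i \<equiv> kept_on b l (\<lambda>t. i \<le> h t)"

abbreviation (input) lane_debt :: "nat \<Rightarrow> nat \<Rightarrow> real" where
  "lane_debt i \<equiv> idle_debt b l (\<lambda>t. i \<le> h t)"

abbreviation (input) lane_collected :: "nat \<Rightarrow> nat \<Rightarrow> real" where
  "lane_collected i \<equiv> collected_debt b l (\<lambda>t. i \<le> h t)"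

abbreviation (input) lane_cost :: "nat \<Rightarrow> nat \<Rightarrow> real" where
  "lane_cost i \<equiv> rental_cost b l (\<lambda>t. i \<le> h t)"

definition lanes_on :: "nat \<Rightarrow> nat \<Rightarrow> nat set" where
  "lanes_on m t = {i\<in>{1..m}. lane_on i t}"

lemma lanes_on_0 [simp]: "lanes_on m 0 = {}"
  by (simp add: lanes_on_def)

lemma finite_lanes_on [simp]: "finite (lanes_on m t)"
  by (simp add: lanes_on_def)

lemma card_lanes_on_le: "card (lanes_on m t) \<le> m"
  by (rule order_trans[OF card_mono[of "{1..m}"]]) (auto simp: lanes_on_def)

lemma requested_subset_lanes_on:
  assumes "1 \<le> t" "h t \<le> m"
  shows "{1..h t} \<subseteq> lanes_on m t"
  using assms by (cases t) (auto simp: lanes_on_def)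

lemma requested_le_card_lanes_on:
  assumes "1 \<le> t" "h t \<le> m"
  shows "h t \<le> card (lanes_on m t)"
  using card_mono[OF finite_lanes_on requested_subset_lanes_on[of t m]] assms by simp

lemma lanes_idle_cost_eq:
  assumes "1 \<le> t" "h t \<le> m"
  shows "c * (real (card (lanes_on m t)) - real (h t))
    = (\<Sum>i=1..m. if lane_on i t \<and> \<not> i \<le> h t then c else 0)"
proof -
  let ?S = "lanes_on m t"
  have "real (card (?S - {1..h t})) = real (card ?S) - real (h t)"
    using requested_subset_lanes_on[of t m] requested_le_card_lanes_on[of t m] assms
    by (simp add: card_Diff_subset of_nat_diff)
  moreover have "?S - {1..h t} = {i\<in>{1..m}. lane_on i t \<and> \<not> i \<le> h t}"
    by (auto simp: lanes_on_def)
  ultimately show ?thesis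
    by (simp add: sum.If_cases Int_def mult.commute)
qed

lemma lanes_switching_cost_le:
  assumes "0 \<le> c"
  shows "c * max (real (card (lanes_on m t)) - real (card (lanes_on m s))) 0
    \<le> (\<Sum>i=1..m. if lane_on i t \<and> \<not> lane_on i s then c else 0)"
proof -
  let ?S = "lanes_on m t" and ?S' = "lanes_on m s"
  have "card ?S - card ?S' \<le> card (?S - ?S')"
    by (rule diff_card_le_card_Diff) simp
  then have "max (real (card ?S) - real (card ?S')) 0 \<le> real (card (?S - ?S'))"
    by linarith
  then have "c * max (real (card ?S) - real (card ?S')) 0 \<le> c * real (card (?S - ?S'))"
    using assms by (rule mult_left_mono)
  moreover have "?S - ?S' = {i\<in>{1..m}. lane_on i t \<and> \<not> lane_on i s}"
    unfolding lanes_on_def by blast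
  ultimately show ?thesis
    by (simp add: sum.If_cases Int_def mult.commute)
qed

lemma lanes_cost_le_rental_cost:
  assumes "0 \<le> b" "\<And>s. s \<in> {1..t} \<Longrightarrow> h s \<le> m"
  shows "(\<Sum>s=1..t. l s * (real (card (lanes_on m s)) - real (h s)) +
      b * max (real (card (lanes_on m s)) - real (card (lanes_on m (s - 1)))) 0)
    \<le> (\<Sum>i=1..m. lane_cost i t)"
proof -
  have "(\<Sum>s=1..t. l s * (real (card (lanes_on m s)) - real (h s)) +
      b * max (real (card (lanes_on m s)) - real (card (lanes_on m (s - 1)))) 0)
    \<le> (\<Sum>s=1..t.
      (\<Sum>i=1..m. if lane_on i s \<and> \<not> i \<le> h s then l s else 0) +
      (\<Sum>i=1..m. if lane_on i s \<and> \<not> lane_on i (s - 1) then b else 0))"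
    using assms by (intro sum_mono add_mono eq_refl[OF lanes_idle_cost_eq] lanes_switching_cost_le) auto
  also have "\<dots> = (\<Sum>i=1..m. lane_cost i t)"
    unfolding rental_cost_def sum.distrib[symmetric] by (rule sum.swap)
  finally show ?thesis .
qed

lemma collected_plus_idle_debt_Suc:
  assumes "h (Suc t) \<le> m"
  shows "(\<Sum>i=1..m. lane_collected i (Suc t)) + (\<Sum>i=1..n. lane_debt i (Suc t))
    = (\<Sum>i=1..m. lane_collected i t)
      + (\<Sum>i=1..max n (h (Suc t)). min b (lane_debt i t + l (Suc t)))"
proof -
  let ?h = "h (Suc t)"
  define v where "v i = min b (lane_debt i t + l (Suc t))" for i
  have "(\<Sum>i=1..m. if i \<le> ?h then v i else 0) = (\<Sum>i=1..?h. v i)"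
    using assms by (intro sum.mono_neutral_cong_right) auto
  moreover have "(\<Sum>i=1..n. if i \<le> ?h then 0 else v i) = (\<Sum>i=?h+1..max n ?h. v i)"
    by (intro sum.mono_neutral_cong_right) auto
  moreover have "(\<Sum>i=1..max n ?h. v i) = (\<Sum>i=1..?h. v i) + (\<Sum>i=?h+1..max n ?h. v i)"
    using sum.ub_add_nat[of 1 ?h v "max n ?h - ?h"] by simp
  ultimately show ?thesis
    by (simp add: sum.distrib flip: v_def cong: if_cong)
qed

text \<open>Think of \<open>w t n\<close> as the least cost of serving slots \<open>1, \<dots>, t\<close> and ending with \<open>n\<close> servers
  on: the demand minimizes it, and \<open>k\<close> servers that stay on in slot \<open>t + 1\<close> cost \<open>l (t + 1)\<close>
  each.\<close>

lemma collected_plus_idle_debt_le_work: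
  fixes w :: "nat \<Rightarrow> nat \<Rightarrow> ereal"
  assumes start: "\<And>n. ereal (b * real n) \<le> w 0 n"
    and step: "\<And>t n. t < T \<Longrightarrow> (INF k\<in>{..n}. w t k
      + ereal (l (Suc t) * real k + b * (real n - real k))) \<le> w (Suc t) n"
    and minimal: "\<And>t n. t < T \<Longrightarrow> w (Suc t) (h (Suc t)) \<le> w (Suc t) n"
    and demand_le: "\<And>t. t < T \<Longrightarrow> h (Suc t) \<le> m"
    and "t \<le> T"
  shows "ereal ((\<Sum>i=1..m. lane_collected i t) + (\<Sum>i=1..n. lane_debt i t)) \<le> w t n"
  using \<open>t \<le> T\<close>
proof (induction t arbitrary: n)
  case 0
  then show ?case using start[of n] by (simp add: mult.commute)
next
  case (Suc t)
  let ?G = "\<Sum>i=1..m. lane_collected i t"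
  let ?v = "\<lambda>i. min b (lane_debt i t + l (Suc t))"
  have "t < T" using Suc.prems by simp
  have capped: "ereal (?G + (\<Sum>i=1..n. ?v i)) \<le> w (Suc t) n" for n
  proof (rule order_trans[OF INF_greatest step[OF \<open>t < T\<close>]])
    fix k assume "k \<in> {..n}"
    then have "ereal (?G + (\<Sum>i=1..n. ?v i))
        \<le> ereal (?G + (\<Sum>i=1..k. lane_debt i t)) + ereal (l (Suc t) * real k + b * (real n - real k))"
      using sum_min_le[of k n b "\<lambda>i. lane_debt i t" "l (Suc t)"] by simp
    also have "\<dots> \<le> w t k + ereal (l (Suc t) * real k + b * (real n - real k))"
      using Suc.IH \<open>t < T\<close> by (intro add_right_mono) simp
    finally show "ereal (?G + (\<Sum>i=1..n. ?v i)) \<le> \<dots>" .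
  qed
  have "ereal (?G + (\<Sum>i=1..max n (h (Suc t)). ?v i)) \<le> w (Suc t) (max n (h (Suc t)))"
    by (rule capped)
  also have "\<dots> \<le> w (Suc t) n"
    using minimal[OF \<open>t < T\<close>] by (simp add: max_def)
  finally show ?case
    unfolding collected_plus_idle_debt_Suc[of t m n, OF demand_le[OF \<open>t < T\<close>]] .
qed

end

lemma lanes_on_cong:
  assumes "\<And>s. s \<in> {1..t} \<Longrightarrow> l s = l' s" "\<And>s. s \<in> {1..t} \<Longrightarrow> h s = h' s"
  shows "lanes_on b l h m t = lanes_on b l' h' m t"
  unfolding lanes_on_def
  using assms by (intro Collect_cong conj_cong refl kept_on_cong) auto

section \<open>Operating costs\<close>

lemma convex_on_perspective_le:
  fixes f :: "'a::real_vector \<Rightarrow> real"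
  assumes convex: "convex_on S f" and mem: "0 \<in> S" "w /\<^sub>R y \<in> S" and "0 < y" "y \<le> x"
  shows "x * f (w /\<^sub>R x) \<le> y * f (w /\<^sub>R y) + (x - y) * f 0"
proof -
  define u where "u = y / x"
  have u: "0 \<le> u" "u \<le> 1" and "0 < x"
    using assms by (auto simp: u_def)
  have "w /\<^sub>R x = (1 - u) *\<^sub>R 0 + u *\<^sub>R (w /\<^sub>R y)"
    using \<open>0 < y\<close> by (simp add: u_def divide_inverse)
  then have "f (w /\<^sub>R x) \<le> (1 - u) * f 0 + u * f (w /\<^sub>R y)"
    using convex_onD[OF convex u mem] by (simp only:)
  then have "x * f (w /\<^sub>R x) \<le> x * ((1 - u) * f 0 + u * f (w /\<^sub>R y))"
    using \<open>0 < x\<close> by simp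
  also have "\<dots> = y * f (w /\<^sub>R y) + (x - y) * f 0"
    using \<open>0 < x\<close> by (simp add: u_def field_simps)
  finally show ?thesis .
qed

lemma operating_cost_fun_finite_iff:
  assumes "operating_cost_fun c f" "0 \<le> z"
  shows "f z < \<infinity> \<longleftrightarrow> z \<le> c"
  using assms by (cases "z \<le> c") (auto simp: operating_cost_fun_def)

lemma operating_cost_fun_eq_real:
  assumes "operating_cost_fun c f" "z \<in> {0..c}"
  shows "f z = ereal (real_of_ereal (f z))"
  using assms by (auto simp: operating_cost_fun_def ereal_real)

lemma operating_cost_fun_at_zero_le:
  assumes "operating_cost_fun c f" "0 < c" "0 \<le> z"
  shows "f 0 \<le> f z"
proof (cases "z \<le> c")
  case True
  then show ?thesis
    using assms by (auto simp: operating_cost_fun_def intro: mono_onD)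
qed (use assms in \<open>simp add: operating_cost_fun_def\<close>)

lemma operating_cost_fun_perspective_le:
  assumes cost_fun: "operating_cost_fun c f" and "0 \<le> w" "0 < y" "y \<le> x"
  shows "ereal x * f (w / x) \<le> ereal y * f (w / y) + ereal ((x - y) * real_of_ereal (f 0))"
proof (cases "w / y \<le> c")
  case False
  then have "f (w / y) = \<infinity>"
    using cost_fun by (simp add: operating_cost_fun_def)
  then show ?thesis
    using \<open>0 < y\<close> by simp
next
  case True
  let ?F = "\<lambda>z. real_of_ereal (f z)"
  have "w / x \<le> w / y"
    using assms by (intro divide_left_mono) auto
  then have loads: "0 \<in> {0..c}" "w / y \<in> {0..c}" "w / x \<in> {0..c}"
    using assms True order_trans[OF divide_nonneg_pos[of w y] True] by auto
  have "convex_on {0..c} ?F"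
    using cost_fun by (simp add: operating_cost_fun_def)
  then have "x * ?F (w / x) \<le> y * ?F (w / y) + (x - y) * ?F 0"
    using convex_on_perspective_le[of "{0..c}" ?F y w x] loads assms
    by (simp add: divide_inverse mult.commute)
  moreover have "f (w / x) = ereal (?F (w / x))" "f (w / y) = ereal (?F (w / y))"
    using operating_cost_fun_eq_real[OF cost_fun] loads by auto
  ultimately show ?thesis
    by (metis ereal_less_eq(3) plus_ereal.simps(1) times_ereal.simps(1))
qed

definition idle_cost :: "dc_problem \<Rightarrow> nat \<Rightarrow> nat \<Rightarrow> real" where
  "idle_cost I t j = real_of_ereal (opcost I t j 0)"

lemma proportional_load_split:
  fixes a :: "nat \<Rightarrow> real"
  assumes a_nonneg: "\<And>j. j \<in> {1..d} \<Longrightarrow> 0 \<le> a j"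
    and v_bounds: "0 \<le> v" "v \<le> (\<Sum>j=1..d. a j)" and "1 \<le> d"
  obtains z where "z \<in> load_splits d" "\<And>j. j \<in> {1..d} \<Longrightarrow> v * z j \<le> a j"
proof (cases "(\<Sum>j=1..d. a j) = 0")
  case True
  have "(\<lambda>j. if j = 1 then 1 else 0) \<in> load_splits d"
    using \<open>1 \<le> d\<close> by (auto simp: load_splits_def)
  then show thesis
    using that True v_bounds a_nonneg by simp
next
  case False
  let ?s = "\<Sum>j=1..d. a j"
  have total_pos: "0 < ?s" using False v_bounds by simp
  show thesis
  proof (rule that)
    have "a j \<le> ?s" if "j \<in> {1..d}" for j
      using that a_nonneg by (intro member_le_sum) auto
    then show "(\<lambda>j. a j / ?s) \<in> load_splits d"
      using a_nonneg total_pos by (auto simp: load_splits_def divide_le_eq_1 simp flip: sum_divide_distrib)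
    show "v * (a j / ?s) \<le> a j" if "j \<in> {1..d}" for j
      using mult_right_mono[OF v_bounds(2) a_nonneg[OF that]] total_pos
      by (simp add: divide_le_eq mult.commute)
  qed
qed

lemma ex_load_split_iff:
  fixes a :: "nat \<Rightarrow> real"
  assumes "\<And>j. j \<in> {1..d} \<Longrightarrow> 0 \<le> a j" "0 \<le> v" "1 \<le> d"
  shows "(\<exists>z\<in>load_splits d. \<forall>j\<in>{1..d}. v * z j \<le> a j) \<longleftrightarrow> v \<le> (\<Sum>j=1..d. a j)"
proof
  assume "\<exists>z\<in>load_splits d. \<forall>j\<in>{1..d}. v * z j \<le> a j"
  then obtain z where z: "z \<in> load_splits d" "\<And>j. j \<in> {1..d} \<Longrightarrow> v * z j \<le> a j"
    by blast
  have "v = (\<Sum>j=1..d. v * z j)"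
    using z(1) by (simp add: load_splits_def flip: sum_distrib_left)
  also have "\<dots> \<le> (\<Sum>j=1..d. a j)"
    by (intro sum_mono z(2))
  finally show "v \<le> \<dots>" .
qed (metis proportional_load_split assms)

lemma load_splits_nonneg:
  assumes "z \<in> load_splits d" "j \<in> {1..d}"
  shows "0 \<le> z j"
  using assms by (simp add: load_splits_def)

locale data_center =
  fixes I :: dc_problem
  assumes dc_instance: "dc_instance I"
begin

abbreviation T :: nat where
  "T \<equiv> horizon I"

abbreviation d :: nat where
  "d \<equiv> ntypes I"

abbreviation \<beta> :: "nat \<Rightarrow> real" where
  "\<beta> \<equiv> swcost I"

lemma ntypes_pos: "1 \<le> d"
  using dc_instance by (simp add: dc_instance_def)

lemma swcost_nonneg: "j \<in> {1..d} \<Longrightarrow> 0 \<le> \<beta> j"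
  using dc_instance by (simp add: dc_instance_def less_imp_le)

lemma capacity_pos: "j \<in> {1..d} \<Longrightarrow> 0 < capacity I j"
  using dc_instance by (simp add: dc_instance_def)

lemma volume_nonneg: "t \<in> {1..T} \<Longrightarrow> 0 \<le> volume I t"
  using dc_instance by (simp add: dc_instance_def)

lemma operating_cost_fun_opcost:
  "t \<in> {1..T} \<Longrightarrow> j \<in> {1..d} \<Longrightarrow> operating_cost_fun (capacity I j) (opcost I t j)"
  using dc_instance by (simp add: dc_instance_def)

context
  fixes t j :: nat
  assumes t: "t \<in> {1..T}" and j: "j \<in> {1..d}"
begin

lemma opcost_0_eq_idle_cost: "opcost I t j 0 = ereal (idle_cost I t j)"
  using operating_cost_fun_eq_real[OF operating_cost_fun_opcost[OF t j], of 0] capacity_pos[OF j]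
  by (simp add: idle_cost_def)

lemma idle_cost_nonneg: "0 \<le> idle_cost I t j"
  using operating_cost_fun_opcost[OF t j] capacity_pos[OF j]
  by (simp add: operating_cost_fun_def idle_cost_def real_of_ereal_pos)

lemma idle_cost_le_type_cost:
  assumes "0 \<le> z"
  shows "ereal (idle_cost I t j * real x) \<le> type_cost I t j x z"
proof (cases "x = 0")
  case False
  have "opcost I t j 0 \<le> opcost I t j (volume I t * z / real x)"
    using operating_cost_fun_at_zero_le[OF operating_cost_fun_opcost[OF t j] capacity_pos[OF j]]
      assms volume_nonneg[OF t] by simp
  then have "ereal (real x) * opcost I t j 0
      \<le> ereal (real x) * opcost I t j (volume I t * z / real x)"
    by (intro ereal_mult_left_mono) auto
  then show ?thesis
    using False by (simp add: type_cost_def opcost_0_eq_idle_cost mult.commute)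
qed (simp add: type_cost_def)

lemma type_cost_le_add_idle_cost:
  assumes "0 \<le> z" "y \<le> x"
  shows "type_cost I t j x z \<le> type_cost I t j y z + ereal (idle_cost I t j * (real x - real y))"
proof -
  consider "0 < y" | "y = 0" "volume I t * z = 0" | "y = 0" "0 < volume I t * z"
    using assms(1) volume_nonneg[OF t] mult_nonneg_nonneg[of "volume I t" z] by fastforce
  then show ?thesis
  proof cases
    case 1
    then show ?thesis
      using operating_cost_fun_perspective_le[OF operating_cost_fun_opcost[OF t j],
          of "volume I t * z" "real y" "real x"] assms volume_nonneg[OF t]
      by (simp add: type_cost_def idle_cost_def mult.commute)
  next
    case 2
    then show ?thesis
      by (auto simp: type_cost_def opcost_0_eq_idle_cost mult.commute)
  next
    case 3
    then show ?thesis
      by (simp add: type_cost_def)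
  qed
qed

lemma type_cost_finite_iff:
  assumes "0 \<le> z"
  shows "type_cost I t j x z < \<infinity> \<longleftrightarrow> volume I t * z \<le> real x * capacity I j"
proof (cases "x = 0")
  case False
  have "ereal (real x) * c < \<infinity> \<longleftrightarrow> c < \<infinity>" for c
    using False by (cases c) auto
  then show ?thesis
    using False assms volume_nonneg[OF t]
      operating_cost_fun_finite_iff[OF operating_cost_fun_opcost[OF t j], of "volume I t * z / real x"]
    by (simp add: type_cost_def divide_le_eq mult.commute)
qed (simp add: type_cost_def)

end

lemma sum_idle_cost_le_slot_cost:
  assumes "t \<in> {1..T}"
  shows "ereal (\<Sum>j=1..d. idle_cost I t j * real (x j)) \<le> slot_cost I t x"
  unfolding slot_cost_def sum_ereal[symmetric]
  using assms by (intro INF_greatest sum_mono idle_cost_le_type_cost) (auto intro: load_splits_nonneg)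

lemma slot_cost_nonneg:
  assumes "t \<in> {1..T}"
  shows "0 \<le> slot_cost I t x"
proof -
  have "0 \<le> (\<Sum>j=1..d. idle_cost I t j * real (x j))"
    using idle_cost_nonneg[OF assms] by (intro sum_nonneg mult_nonneg_nonneg) auto
  then show ?thesis
    using order_trans[OF _ sum_idle_cost_le_slot_cost[OF assms]] by simp
qed

lemma slot_cost_le_add_idle_cost:
  assumes "t \<in> {1..T}" and y_le_x: "\<And>j. j \<in> {1..d} \<Longrightarrow> y j \<le> x j"
  shows "slot_cost I t x
    \<le> slot_cost I t y + ereal (\<Sum>j=1..d. idle_cost I t j * (real (x j) - real (y j)))"
    (is "_ \<le> _ + ereal ?idle")
proof -
  have "slot_cost I t x - ereal ?idle \<le> slot_cost I t y"
    unfolding slot_cost_def[of I t y]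
  proof (rule INF_greatest)
    fix z assume z: "z \<in> load_splits d"
    have "slot_cost I t x \<le> (\<Sum>j=1..d. type_cost I t j (x j) (z j))"
      unfolding slot_cost_def by (rule INF_lower[OF z])
    also have "\<dots> \<le> (\<Sum>j=1..d. type_cost I t j (y j) (z j)
        + ereal (idle_cost I t j * (real (x j) - real (y j))))"
      using z y_le_x assms(1) by (intro sum_mono type_cost_le_add_idle_cost) (auto intro: load_splits_nonneg)
    also have "\<dots> = (\<Sum>j=1..d. type_cost I t j (y j) (z j)) + ereal ?idle"
      by (simp add: sum.distrib)
    finally show "slot_cost I t x - ereal ?idle \<le> (\<Sum>j=1..d. type_cost I t j (y j) (z j))"
      by (simp add: ereal_minus_le)
  qed
  then show ?thesis
    by (simp add: ereal_minus_le)
qed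

lemma slot_cost_finite_iff:
  assumes t: "t \<in> {1..T}"
  shows "slot_cost I t x < \<infinity> \<longleftrightarrow> volume I t \<le> (\<Sum>j=1..d. real (x j) * capacity I j)"
proof -
  have "(\<Sum>j=1..d. type_cost I t j (x j) (z j)) < \<infinity>
      \<longleftrightarrow> (\<forall>j\<in>{1..d}. volume I t * z j \<le> real (x j) * capacity I j)" if "z \<in> load_splits d" for z
    using type_cost_finite_iff[OF t] load_splits_nonneg[OF that]
    by (auto simp: sum_Pinfty simp flip: less_top)
  then have "slot_cost I t x < \<infinity>
      \<longleftrightarrow> (\<exists>z\<in>load_splits d. \<forall>j\<in>{1..d}. volume I t * z j \<le> real (x j) * capacity I j)"
    unfolding slot_cost_def INF_less_iff by blast
  also have "\<dots> \<longleftrightarrow> volume I t \<le> (\<Sum>j=1..d. real (x j) * capacity I j)"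
    using capacity_pos volume_nonneg[OF t] ntypes_pos
    by (intro ex_load_split_iff mult_nonneg_nonneg) (auto simp: less_imp_le)
  finally show ?thesis .
qed

end

section \<open>Prefix schedules and demands\<close>

definition switching_cost :: "dc_problem \<Rightarrow> (nat \<Rightarrow> nat) \<Rightarrow> (nat \<Rightarrow> nat) \<Rightarrow> real" where
  "switching_cost I x y = (\<Sum>j=1..ntypes I. swcost I j * max (real (y j) - real (x j)) 0)"

definition prefix_cost :: "dc_problem \<Rightarrow> nat \<Rightarrow> schedule \<Rightarrow> ereal" where
  "prefix_cost I t X = (\<Sum>s=1..t. slot_cost I s (X s) + ereal (switching_cost I (X (s - 1)) (X s)))"

definition prefix_schedule :: "dc_problem \<Rightarrow> nat \<Rightarrow> schedule \<Rightarrow> bool" where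
  "prefix_schedule I t X \<longleftrightarrow>
     (\<forall>j\<in>{1..ntypes I}. X 0 j = 0 \<and> (\<forall>s\<in>{1..t}. X s j \<le> servers I j))"

definition prefix_optimal :: "dc_problem \<Rightarrow> nat \<Rightarrow> schedule \<Rightarrow> bool" where
  "prefix_optimal I t X \<longleftrightarrow> prefix_schedule I t X \<and>
     (\<forall>Y. prefix_schedule I t Y \<longrightarrow> prefix_cost I t X \<le> prefix_cost I t Y)"

definition demand :: "dc_problem \<Rightarrow> nat \<Rightarrow> nat \<Rightarrow> nat" where
  "demand I t = (SOME X. prefix_optimal I t X) t"

lemma prefix_cost_0 [simp]: "prefix_cost I 0 X = 0"
  by (simp add: prefix_cost_def)

lemma prefix_cost_Suc:
  "prefix_cost I (Suc t) X = prefix_cost I t X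
     + (slot_cost I (Suc t) (X (Suc t)) + ereal (switching_cost I (X t) (X (Suc t))))"
  by (simp add: prefix_cost_def)

lemma schedule_cost_eq_prefix_cost: "schedule_cost I X = prefix_cost I (horizon I) X"
  by (simp add: schedule_cost_def prefix_cost_def switching_cost_def)

lemma prefix_schedule_SucD: "prefix_schedule I (Suc t) X \<Longrightarrow> prefix_schedule I t X"
  by (auto simp: prefix_schedule_def)

lemma prefix_schedule_le_servers:
  "prefix_schedule I t X \<Longrightarrow> s \<le> t \<Longrightarrow> j \<in> {1..ntypes I} \<Longrightarrow> X s j \<le> servers I j"
  by (cases "s = 0") (auto simp: prefix_schedule_def)

lemma is_schedule_imp_prefix_schedule: "is_schedule I X \<Longrightarrow> prefix_schedule I (horizon I) X"
  by (auto simp: prefix_schedule_def is_schedule_def)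

lemma slot_cost_cong:
  "(\<And>j. j \<in> {1..ntypes I} \<Longrightarrow> x j = y j) \<Longrightarrow> slot_cost I t x = slot_cost I t y"
  unfolding slot_cost_def by (intro INF_cong sum.cong) auto

lemma prefix_cost_cong:
  assumes "\<And>s j. s \<le> t \<Longrightarrow> j \<in> {1..ntypes I} \<Longrightarrow> X s j = Y s j"
  shows "prefix_cost I t X = prefix_cost I t Y"
  unfolding prefix_cost_def switching_cost_def
  using assms
  by (intro sum.cong refl arg_cong2[where f = plus] slot_cost_cong arg_cong[where f = ereal]) auto

lemma finite_prefix_costs: "finite (prefix_cost I t ` {X. prefix_schedule I t X})"
proof (rule finite_subset)
  let ?P = "\<Pi>\<^sub>E s\<in>{..t}. \<Pi>\<^sub>E j\<in>{1..ntypes I}. {..servers I j}"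
  show "finite (prefix_cost I t ` ?P)"
    by (intro finite_imageI finite_PiE) auto
  show "prefix_cost I t ` {X. prefix_schedule I t X} \<subseteq> prefix_cost I t ` ?P"
  proof (rule image_subsetI)
    fix X assume "X \<in> {X. prefix_schedule I t X}"
    then have "(\<lambda>s\<in>{..t}. restrict (X s) {1..ntypes I}) \<in> ?P"
      using prefix_schedule_le_servers by auto
    moreover have "prefix_cost I t X = prefix_cost I t (\<lambda>s\<in>{..t}. restrict (X s) {1..ntypes I})"
      by (rule prefix_cost_cong) simp
    ultimately show "prefix_cost I t X \<in> prefix_cost I t ` ?P"
      by blast
  qed
qed

lemma prefix_optimal_exists: "\<exists>X. prefix_optimal I t X"
proof -
  let ?S = "{X. prefix_schedule I t X}"
  have "(\<lambda>_ _. 0) \<in> ?S" by (simp add: prefix_schedule_def)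
  then have "Min (prefix_cost I t ` ?S) \<in> prefix_cost I t ` ?S"
    using finite_prefix_costs by (intro Min_in) auto
  then obtain X where "X \<in> ?S" "prefix_cost I t X = Min (prefix_cost I t ` ?S)" by auto
  then show ?thesis
    using finite_prefix_costs by (auto simp: prefix_optimal_def)
qed

lemma demand_prefix_optimal:
  obtains X where "prefix_optimal I t X" "demand I t = X t"
  using someI_ex[OF prefix_optimal_exists] by (auto simp: demand_def)

lemma demand_le_servers:
  assumes "j \<in> {1..ntypes I}"
  shows "demand I t j \<le> servers I j"
proof -
  obtain X where "prefix_optimal I t X" "demand I t = X t"
    by (rule demand_prefix_optimal)
  then show ?thesis
    using prefix_schedule_le_servers[of I t X t j] assms by (simp add: prefix_optimal_def)
qed

context data_center
begin

lemma switching_cost_nonneg: "0 \<le> switching_cost I x y"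
  unfolding switching_cost_def
  using swcost_nonneg by (intro sum_nonneg mult_nonneg_nonneg) auto

lemma swcost_le_switching_cost:
  assumes "j \<in> {1..d}"
  shows "\<beta> j * max (real (y j) - real (x j)) 0 \<le> switching_cost I x y"
  unfolding switching_cost_def
  using assms swcost_nonneg by (intro member_le_sum) auto

lemma idle_cost_le_slot_cost:
  assumes "t \<in> {1..T}" "j \<in> {1..d}"
  shows "ereal (idle_cost I t j * real (x j)) \<le> slot_cost I t x"
proof -
  have "idle_cost I t j * real (x j) \<le> (\<Sum>j=1..d. idle_cost I t j * real (x j))"
    using assms idle_cost_nonneg by (intro member_le_sum) auto
  then show ?thesis
    using order_trans[OF _ sum_idle_cost_le_slot_cost[OF assms(1), of x]] by simp
qed

lemma schedule_cost_nonneg: "0 \<le> schedule_cost I X"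
  unfolding schedule_cost_eq_prefix_cost prefix_cost_def
  using slot_cost_nonneg switching_cost_nonneg by (intro sum_nonneg add_nonneg_nonneg) auto

lemma schedule_cost_finite_iff:
  assumes "is_schedule I X"
  shows "schedule_cost I X < \<infinity> \<longleftrightarrow> feasible I X"
proof -
  have "schedule_cost I X < \<infinity> \<longleftrightarrow> (\<forall>t\<in>{1..T}. slot_cost I t (X t) < \<infinity>)"
    unfolding schedule_cost_def by (auto simp: sum_Pinfty simp flip: less_top)
  also have "\<dots> \<longleftrightarrow> feasible I X"
    using slot_cost_finite_iff assms by (simp add: feasible_def)
  finally show ?thesis .
qed

lemma sum_slot_cost_demand_le_prefix_cost:
  assumes "t \<le> T" "prefix_schedule I t X"
  shows "(\<Sum>s=1..t. slot_cost I s (demand I s)) \<le> prefix_cost I t X"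
  using assms
proof (induction t arbitrary: X)
  case (Suc t)
  obtain Y where Y: "prefix_optimal I (Suc t) Y" "demand I (Suc t) = Y (Suc t)"
    by (rule demand_prefix_optimal)
  have "(\<Sum>s=1..t. slot_cost I s (demand I s)) \<le> prefix_cost I t Y"
    using Suc.IH[of Y] Suc.prems(1) Y(1) prefix_schedule_SucD by (simp add: prefix_optimal_def)
  moreover have "slot_cost I (Suc t) (Y (Suc t))
      \<le> slot_cost I (Suc t) (Y (Suc t)) + ereal (switching_cost I (Y t) (Y (Suc t)))"
    using switching_cost_nonneg by (intro ereal_le_add_self) simp
  ultimately have "(\<Sum>s=1..Suc t. slot_cost I s (demand I s)) \<le> prefix_cost I (Suc t) Y"
    by (simp add: prefix_cost_Suc Y(2) add_mono)
  also have "\<dots> \<le> prefix_cost I (Suc t) X"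
    using Y(1) Suc.prems(2) by (simp add: prefix_optimal_def)
  finally show ?case .
qed simp

end

section \<open>Work functions\<close>

definition work_function :: "dc_problem \<Rightarrow> nat \<Rightarrow> nat \<Rightarrow> nat \<Rightarrow> ereal" where
  "work_function I j t n = (INF X\<in>{X. prefix_schedule I t X}.
     prefix_cost I t X + ereal (swcost I j * max (real n - real (X t j)) 0))"

lemma work_function_le_prefix_cost:
  assumes "prefix_schedule I t X"
  shows "work_function I j t (X t j) \<le> prefix_cost I t X"
proof -
  have "work_function I j t (X t j)
      \<le> prefix_cost I t X + ereal (swcost I j * max (real (X t j) - real (X t j)) 0)"
    unfolding work_function_def using assms by (intro INF_lower) simp
  then show ?thesis by (simp flip: zero_ereal_def)
qed

context data_center
begin

context
  fixes j :: nat
  assumes j: "j \<in> {1..d}"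
begin

lemma work_function_0_ge: "ereal (\<beta> j * real n) \<le> work_function I j 0 n"
  unfolding work_function_def using j by (intro INF_greatest) (simp add: prefix_schedule_def)

lemma idle_plus_switching_cost_le_prefix_cost_Suc:
  assumes "t < T"
  shows "prefix_cost I t X + ereal (idle_cost I (Suc t) j * real (X (Suc t) j)
      + \<beta> j * max (real (X (Suc t) j) - real (X t j)) 0) \<le> prefix_cost I (Suc t) X"
  unfolding prefix_cost_Suc plus_ereal.simps(1)[symmetric]
  using assms j idle_cost_le_slot_cost swcost_le_switching_cost
  by (intro add_left_mono add_mono) auto

text \<open>Of the \<open>n\<close> servers, those already used by the schedule in slot \<open>t + 1\<close> pay the idle cost,
  and the other ones are started afterwards.\<close>

lemma work_function_Suc_ge:
  assumes "t < T"
  shows "(INF k\<in>{..n}. work_function I j t k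
      + ereal (idle_cost I (Suc t) j * real k + \<beta> j * (real n - real k)))
    \<le> work_function I j (Suc t) n"
  unfolding work_function_def[of I j "Suc t"]
proof (rule INF_greatest)
  fix X assume "X \<in> {X. prefix_schedule I (Suc t) X}"
  then have X: "prefix_schedule I t X" by (simp add: prefix_schedule_SucD)
  let ?l = "idle_cost I (Suc t) j" and ?x = "X (Suc t) j"
  define k where "k = min n ?x"
  have "\<beta> j * (max (real k - real (X t j)) 0 + (real n - real k))
      \<le> \<beta> j * (max (real ?x - real (X t j)) 0 + max (real n - real ?x) 0)"
    using swcost_nonneg[OF j] by (intro mult_left_mono) (auto simp: k_def)
  moreover have "?l * real k \<le> ?l * real ?x"
    using idle_cost_nonneg[OF _ j] assms by (intro mult_left_mono) (auto simp: k_def)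
  ultimately have cost_le: "\<beta> j * max (real k - real (X t j)) 0 + (?l * real k + \<beta> j * (real n - real k))
      \<le> (?l * real ?x + \<beta> j * max (real ?x - real (X t j)) 0) + \<beta> j * max (real n - real ?x) 0"
    by (simp add: algebra_simps)
  have "(INF k\<in>{..n}. work_function I j t k + ereal (?l * real k + \<beta> j * (real n - real k)))
      \<le> work_function I j t k + ereal (?l * real k + \<beta> j * (real n - real k))"
    by (intro INF_lower) (simp add: k_def)
  also have "\<dots> \<le> (prefix_cost I t X + ereal (\<beta> j * max (real k - real (X t j)) 0))
      + ereal (?l * real k + \<beta> j * (real n - real k))"
    unfolding work_function_def using X by (intro add_right_mono INF_lower) simp
  also have "\<dots> \<le> (prefix_cost I t X + ereal (?l * real ?x + \<beta> j * max (real ?x - real (X t j)) 0))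
      + ereal (\<beta> j * max (real n - real ?x) 0)"
    using cost_le by (simp add: add.assoc add_left_mono)
  also have "\<dots> \<le> prefix_cost I (Suc t) X + ereal (\<beta> j * max (real n - real ?x) 0)"
    by (intro add_right_mono idle_plus_switching_cost_le_prefix_cost_Suc assms)
  finally show "(INF k\<in>{..n}. work_function I j t k
      + ereal (?l * real k + \<beta> j * (real n - real k))) \<le> \<dots>" .
qed

lemma work_function_demand_le: "work_function I j t (demand I t j) \<le> work_function I j t n"
  unfolding work_function_def[of I j t n]
proof (rule INF_greatest)
  fix X assume X: "X \<in> {X. prefix_schedule I t X}"
  obtain Y where Y: "prefix_optimal I t Y" "demand I t = Y t"
    by (rule demand_prefix_optimal)
  then have "work_function I j t (demand I t j) \<le> prefix_cost I t X"
    using X order_trans[OF work_function_le_prefix_cost] by (simp add: prefix_optimal_def)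
  also have "\<dots> \<le> prefix_cost I t X + ereal (\<beta> j * max (real n - real (X t j)) 0)"
    using swcost_nonneg[OF j] by (intro ereal_le_add_self) simp
  finally show "work_function I j t (demand I t j) \<le> \<dots>" .
qed

lemma collected_debt_le_schedule_cost:
  assumes "is_schedule I X"
  shows "ereal (\<Sum>i=1..servers I j. lane_collected (\<beta> j) (\<lambda>t. idle_cost I t j) (\<lambda>t. demand I t j) i T)
    \<le> schedule_cost I X" (is "ereal ?collected \<le> _")
proof -
  let ?debt = "\<lambda>i. lane_debt (\<beta> j) (\<lambda>t. idle_cost I t j) (\<lambda>t. demand I t j) i T"
  have "0 \<le> ?debt i" for i
    using swcost_nonneg[OF j] idle_cost_nonneg[OF _ j] by (intro idle_debt_bounds) auto
  then have "ereal ?collected \<le> ereal (?collected + (\<Sum>i=1..X T j. ?debt i))"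
    by (simp add: sum_nonneg)
  also have "\<dots> \<le> work_function I j T (X T j)"
    by (intro collected_plus_idle_debt_le_work[where T = T] work_function_0_ge work_function_Suc_ge
        work_function_demand_le demand_le_servers j order_refl)
  also have "\<dots> \<le> schedule_cost I X"
    unfolding schedule_cost_eq_prefix_cost
    using assms by (intro work_function_le_prefix_cost is_schedule_imp_prefix_schedule)
  finally show ?thesis .
qed

end

end

section \<open>The online algorithm\<close>

definition right_size :: "dc_problem \<Rightarrow> schedule" where
  "right_size I t j = (if t \<le> horizon I
     then card (lanes_on (swcost I j) (\<lambda>s. idle_cost I s j) (\<lambda>s. demand I s j) (servers I j) t)
     else 0)"

lemma is_schedule_right_size: "is_schedule I (right_size I)"
  by (simp add: is_schedule_def right_size_def card_lanes_on_le)

lemma demand_le_right_size: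
  assumes "t \<in> {1..horizon I}" "j \<in> {1..ntypes I}"
  shows "demand I t j \<le> right_size I t j"
  using assms demand_le_servers requested_le_card_lanes_on[of t "\<lambda>t. demand I t j"]
  by (simp add: right_size_def)

lemma same_information_mono: "same_information t I I' \<Longrightarrow> s \<le> t \<Longrightarrow> same_information s I I'"
  by (auto simp: same_information_def)

lemma slot_cost_same_information:
  assumes "0 \<le> volume I t" "1 \<le> t" "same_information t I I'"
  shows "slot_cost I t x = slot_cost I' t x"
proof -
  have ntypes: "ntypes I' = ntypes I" and volume: "volume I' t = volume I t"
    and opcost: "\<And>j z. j \<in> {1..ntypes I} \<Longrightarrow> 0 \<le> z \<Longrightarrow> opcost I' t j z = opcost I t j z"
    using assms by (auto simp: same_information_def)
  have "type_cost I t j y z = type_cost I' t j y z" if "j \<in> {1..ntypes I}" "0 \<le> z" for j y z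
    using that assms(1) by (simp add: type_cost_def volume opcost)
  then show ?thesis
    unfolding slot_cost_def ntypes by (intro INF_cong sum.cong) (auto simp: load_splits_def)
qed

context data_center
begin

lemma demand_same_information:
  assumes "t \<le> T" "same_information t I I'"
  shows "demand I t = demand I' t"
proof -
  have "ntypes I' = d"
    and "\<And>j. j \<in> {1..d} \<Longrightarrow> servers I' j = servers I j \<and> swcost I' j = \<beta> j"
    using assms by (auto simp: same_information_def)
  then have "switching_cost I = switching_cost I'"
    and schedule: "prefix_schedule I t = prefix_schedule I' t"
    by (auto simp: fun_eq_iff switching_cost_def prefix_schedule_def)
  moreover have "slot_cost I s x = slot_cost I' s x" if "s \<in> {1..t}" for s x
    using that assms volume_nonneg same_information_mono by (intro slot_cost_same_information) auto
  ultimately have "prefix_cost I t = prefix_cost I' t"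
    by (auto simp: fun_eq_iff prefix_cost_def intro!: sum.cong)
  then show ?thesis
    by (simp add: demand_def prefix_optimal_def schedule)
qed

lemma right_size_same_information:
  assumes "t \<in> {1..T}" "same_information t I I'" "j \<in> {1..d}"
  shows "right_size I t j = right_size I' t j"
proof -
  have "demand I s j = demand I' s j" if "s \<in> {1..t}" for s
    using demand_same_information[OF _ same_information_mono[OF assms(2)], of s] that assms(1)
    by simp
  moreover have "idle_cost I s j = idle_cost I' s j" if "s \<in> {1..t}" for s
    using that assms by (simp add: same_information_def idle_cost_def)
  ultimately have "lanes_on b (\<lambda>s. idle_cost I s j) (\<lambda>s. demand I s j) m t
      = lanes_on b (\<lambda>s. idle_cost I' s j) (\<lambda>s. demand I' s j) m t" for b m
    by (intro lanes_on_cong)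
  then show ?thesis
    using assms by (simp add: right_size_def same_information_def)
qed

lemma right_size_overhead_le:
  assumes j: "j \<in> {1..d}" and X: "is_schedule I X" "schedule_cost I X = ereal opt"
  shows "(\<Sum>t=1..T. idle_cost I t j * (real (right_size I t j) - real (demand I t j))
      + \<beta> j * max (real (right_size I t j) - real (right_size I (t - 1) j)) 0) \<le> 2 * opt"
proof -
  let ?l = "\<lambda>t. idle_cost I t j" and ?h = "\<lambda>t. demand I t j"
  let ?on = "lanes_on (\<beta> j) ?l ?h (servers I j)"
  have "(\<Sum>t=1..T. ?l t * (real (right_size I t j) - real (?h t))
      + \<beta> j * max (real (right_size I t j) - real (right_size I (t - 1) j)) 0)
    = (\<Sum>t=1..T. ?l t * (real (card (?on t)) - real (?h t))
      + \<beta> j * max (real (card (?on t)) - real (card (?on (t - 1)))) 0)"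
    by (intro sum.cong refl) (auto simp: right_size_def)
  also have "\<dots> \<le> (\<Sum>i=1..servers I j. lane_cost (\<beta> j) ?l ?h i T)"
    by (intro lanes_cost_le_rental_cost swcost_nonneg demand_le_servers j)
  also have "\<dots> \<le> (\<Sum>i=1..servers I j. 2 * lane_collected (\<beta> j) ?l ?h i T)"
    using j by (intro sum_mono rental_cost_le_collected_debt swcost_nonneg idle_cost_nonneg)
  also have "\<dots> \<le> 2 * opt"
    using collected_debt_le_schedule_cost[OF j X(1)] X(2) by (simp flip: sum_distrib_left)
  finally show ?thesis .
qed

lemma right_size_cost_le:
  assumes X: "feasible I X"
  shows "schedule_cost I (right_size I) \<le> ereal (2 * real d + 1) * schedule_cost I X"
proof -
  have sched: "is_schedule I X" using X by (simp add: feasible_def)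
  then obtain opt where opt: "schedule_cost I X = ereal opt"
    using schedule_cost_nonneg[of X] schedule_cost_finite_iff X
    by (cases "schedule_cost I X") auto
  let ?A = "right_size I" and ?D = "\<lambda>t. slot_cost I t (demand I t)"
  let ?idle = "\<lambda>t j. idle_cost I t j * (real (?A t j) - real (demand I t j))"
  let ?switch = "\<lambda>t j. \<beta> j * max (real (?A t j) - real (?A (t - 1) j)) 0"
  have "schedule_cost I ?A
      \<le> (\<Sum>t=1..T. (?D t + ereal (\<Sum>j=1..d. ?idle t j)) + ereal (\<Sum>j=1..d. ?switch t j))"
    unfolding schedule_cost_def
    by (intro sum_mono add_right_mono slot_cost_le_add_idle_cost demand_le_right_size)
  also have "\<dots> = (\<Sum>t=1..T. ?D t) + ereal (\<Sum>t=1..T. \<Sum>j=1..d. ?idle t j + ?switch t j)"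
    by (simp add: sum.distrib add.assoc)
  also have "\<dots> = (\<Sum>t=1..T. ?D t) + ereal (\<Sum>j=1..d. \<Sum>t=1..T. ?idle t j + ?switch t j)"
    by (subst sum.swap) simp
  also have "\<dots> \<le> schedule_cost I X + ereal (\<Sum>j=1..d. 2 * opt)"
  proof (rule add_mono)
    show "(\<Sum>t=1..T. ?D t) \<le> schedule_cost I X"
      unfolding schedule_cost_eq_prefix_cost
      by (intro sum_slot_cost_demand_le_prefix_cost is_schedule_imp_prefix_schedule sched order_refl)
    show "ereal (\<Sum>j=1..d. \<Sum>t=1..T. ?idle t j + ?switch t j) \<le> ereal (\<Sum>j=1..d. 2 * opt)"
      unfolding ereal_less_eq(3) by (intro sum_mono right_size_overhead_le[OF _ sched opt])
  qed
  also have "\<dots> = ereal (2 * real d + 1) * schedule_cost I X"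
    by (simp add: opt algebra_simps)
  finally show ?thesis .
qed

lemma feasible_right_size:
  assumes "feasible I X"
  shows "feasible I (right_size I)"
proof -
  have "schedule_cost I X < \<infinity>"
    using assms schedule_cost_finite_iff by (simp add: feasible_def)
  then have "ereal (2 * real d + 1) * schedule_cost I X < \<infinity>"
    using schedule_cost_nonneg[of X] by (cases "schedule_cost I X") auto
  then have "schedule_cost I (right_size I) < \<infinity>"
    by (rule le_less_trans[OF right_size_cost_le[OF assms]])
  then show ?thesis
    using schedule_cost_finite_iff[OF is_schedule_right_size] by simp
qed

end

lemma online_algorithm_right_size: "online_algorithm right_size"
  using is_schedule_right_size data_center.right_size_same_information
  by (simp add: online_algorithm_def data_center_def)

lemma competitive_right_size: "competitive right_size d (2 * real d + 1)"
  using data_center.feasible_right_size data_center.right_size_cost_le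
  by (auto simp: competitive_def data_center_def optimal_def)

lemma competitive_mono:
  assumes "competitive A d c" "c \<le> c'"
  shows "competitive A d c'"
  unfolding competitive_def
proof (intro allI impI conjI)
  fix I assume I: "dc_instance I" "ntypes I = d" "\<exists>X. feasible I X"
  then show "feasible I (A I)"
    using assms(1) by (simp add: competitive_def)
  fix X assume "optimal I X"
  then have "schedule_cost I (A I) \<le> ereal c * schedule_cost I X"
    using assms(1) I by (simp add: competitive_def)
  also have "\<dots> \<le> ereal c' * schedule_cost I X"
    using assms(2) data_center.schedule_cost_nonneg[of I X] I(1)
    by (intro ereal_mult_right_mono) (auto simp: data_center_def)
  finally show "schedule_cost I (A I) \<le> ereal c' * schedule_cost I X" .
qed

theorem theorem15:
  fixes \<epsilon> :: real
  assumes "\<epsilon> > 0"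
  shows "\<exists>A. online_algorithm A \<and> (\<forall>d\<ge>1. competitive A d (2 * real d + 1 + \<epsilon>))"
proof (intro exI conjI allI impI)
  show "online_algorithm right_size"
    by (rule online_algorithm_right_size)
  show "competitive right_size d (2 * real d + 1 + \<epsilon>)" for d
    using assms by (intro competitive_mono[OF competitive_right_size]) simp
qed

end
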